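(* For every integer $q\ge 1$, the exponential generating function $G(z)=\sum_{n=0}^{\infty}b_n\frac{z^n}{n!}$ satisfies the $q$th-order differential equation $$(1-z)G^{(q)}(z)-qG^{(q-1)}(z)-(q-1)G(z)=q\,w^{(q)}(z),\qquad G^{(i)}(0)=i!\quad (i=0,1,\ldots,q-1),$$ where $$w(z)=\sum_{i=1}^{\infty}\frac{(-1)^iz^{qi}}{(qi)!}.$$
   Context: $S_n$ is the set of all permutations of $[n]=\{1,2,\ldots,n\}$ (with $S_0$ consisting of the single empty permutation). For a fixed integer $q\ge 1$, an adjacent $q$-cycle (A$q$C) of a permutation $\pi\in S_n$ is a cycle of length $q$ in the disjoint cycle decomposition of $\pi$ of the form $(a,a+1,a+2,\ldots,a+q-1)$, i.e. $\pi(a+i)=a+i+1$ for $0\le i\le q-2$ and $\pi(a+q-1)=a$ (for $q=1$ this is a fixed point). For fixed $q$, $b_n$ denotes the number of permutations in $S_n$ having no A$q$C's (so $b_0=1$ for every $q\ge1$). $G^{(i)}$ denotes the $i$th (formal) derivative of the power series $G$, with $G^{(0)}=G$. *)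

theory Defs
  imports
    Complex_Main
    "HOL-Combinatorics.Permutations"
    "HOL-Computational_Algebra.Formal_Power_Series"
begin

(* p contains the cycle (a, a+1, ..., a+q-1); the whole block has to lie in {1..n}.
   The guard i + 2 \<le> q is i \<le> q - 2 without truncated subtraction, so that for q = 1
   only p a = a remains.  Meant for q \<ge> 1. *)
definition is_AqC_at :: "nat \<Rightarrow> nat \<Rightarrow> (nat \<Rightarrow> nat) \<Rightarrow> nat \<Rightarrow> bool" where
  "is_AqC_at q n p a \<longleftrightarrow>
     1 \<le> a \<and> a + q - 1 \<le> n \<and>
     (\<forall>i. i + 2 \<le> q \<longrightarrow> p (a + i) = a + i + 1) \<and> p (a + q - 1) = a"

definition num_without_AqC :: "nat \<Rightarrow> nat \<Rightarrow> nat" where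
  "num_without_AqC q n = card {p. p permutes {1..n} \<and> \<not> (\<exists>a. is_AqC_at q n p a)}"

definition egf_AqC :: "nat \<Rightarrow> real fps" where
  "egf_AqC q = Abs_fps (\<lambda>n. real (num_without_AqC q n) / fact n)"

(* The sum converges in the topology of formal power series, and the index is shifted
   to start at 0; see w_AqC_sums below. *)
definition w_AqC :: "nat \<Rightarrow> real fps" where
  "w_AqC q = (\<Sum>i. fps_const ((-1) ^ Suc i / fact (q * Suc i)) * fps_X ^ (q * Suc i))"

lemma w_AqC_sums:
  assumes "q \<ge> 1"
  shows "(\<lambda>i. fps_const ((-1) ^ Suc i / fact (q * Suc i)) * fps_X ^ (q * Suc i)) sums w_AqC q"
proof -
  let ?f = "\<lambda>i. fps_const ((-1) ^ Suc i / fact (q * Suc i)) * fps_X ^ (q * Suc i) :: real fps"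
  define S where "S = Abs_fps (\<lambda>m. \<Sum>i<m. fps_nth (?f i) m)"
  have "(\<lambda>n. \<Sum>i<n. ?f i) \<longlonglongrightarrow> S"
    unfolding tendsto_fps_iff
  proof
    fix m
    have "fps_nth (\<Sum>i<n. ?f i) m = fps_nth S m" if "n \<ge> m" for n
    proof -
      have "fps_nth (?f i) m = 0" if "i \<ge> m" for i
      proof -
        have "m < Suc i" using that by simp
        also have "Suc i \<le> q * Suc i" using mult_le_mono1[OF assms, of "Suc i"] by simp
        finally show ?thesis by (simp add: fps_X_power_nth del: mult_Suc_right)
      qed
      hence "(\<Sum>i<n. fps_nth (?f i) m) = (\<Sum>i<m. fps_nth (?f i) m)"
        using that by (intro sum.mono_neutral_right) auto
      thus ?thesis unfolding S_def fps_sum_nth by simp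
    qed
    thus "\<forall>\<^sub>F n in sequentially. fps_nth (\<Sum>i<n. ?f i) m = fps_nth S m"
      using eventually_sequentially by blast
  qed
  hence "?f sums S" unfolding sums_def .
  thus ?thesis unfolding w_AqC_def by (rule summable_sums[OF sums_summable])
qed

end

theory Submission
  imports Defs
begin

text \<open>
  Write \<open>b n\<close> for \<open>num_without_AqC q n\<close>. Comparing coefficients of \<open>z ^ n / n!\<close>,
  the differential equation is the recurrence
  \<open>b m = m * b (m - 1) + (q - 1) * b (m - q) + q * (-1) ^ (m div q) * [q dvd m]\<close> for \<open>m = n + q\<close>,
  and the initial conditions say that \<open>b i = i!\<close> for \<open>i < q\<close>. Both are read off from the
  explicit formula (lemma \<open>num_without_AqC_formula\<close>)
  \<open>b n = (\<Sum>k\<le>n div q. (-1) ^ k * (n - (q - 1) * k)! / k!)\<close>.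

  The formula is an inclusion-exclusion over the sets \<open>A\<close> of starting points of prescribed
  adjacent cycles. Two distinct cycles are disjoint, so \<open>A\<close> contributes only if its members are at
  least \<open>q\<close> apart (lemma \<open>AqC_starts_separated\<close>); then the permutation is prescribed on
  \<open>q * card A\<close> points and arbitrary on the others, which leaves \<open>(n - q * card A)!\<close> choices
  (lemma \<open>card_permutes_AqC_at\<close>). Contracting every block to one point suggests that there are
  \<open>(n - (q - 1) * k) choose k\<close> admissible sets of size \<open>k\<close>, which Pascal's rule confirms (lemma
  \<open>card_block_starts\<close>), and multiplying by \<open>(n - q * k)!\<close> leaves \<open>(n - (q - 1) * k)! / k!\<close>.

  In the recurrence the \<open>k\<close>th terms of \<open>b m\<close> and \<open>m * b (m - 1)\<close> differ by \<open>q - 1\<close> times the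
  term of index \<open>k - 1\<close> of \<open>b (m - q)\<close>. The sums for \<open>m\<close> and \<open>m - 1\<close> have the same range unless
  \<open>q\<close> divides \<open>m\<close>. In that case the top terms \<open>(-1) ^ (m div q)\<close> of \<open>b m\<close> and
  \<open>- (-1) ^ (m div q)\<close> of \<open>b (m - q)\<close> have no partner, and together they leave the
  inhomogeneous term \<open>1 + (q - 1) = q\<close> times \<open>(-1) ^ (m div q)\<close>.
\<close>

section \<open>Permutations with prescribed adjacent cycles\<close>

definition block_starts :: "nat \<Rightarrow> nat \<Rightarrow> nat set set" where
  "block_starts q n = {A. A \<subseteq> {1..n} \<and> (\<forall>a\<in>A. a + q \<le> n + 1) \<and>
     (\<forall>a\<in>A. \<forall>b\<in>A. a < b \<longrightarrow> a + q \<le> b)}"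

definition blocks :: "nat \<Rightarrow> nat set \<Rightarrow> nat set" where
  "blocks q A = (\<Union>a\<in>A. {a..<a + q})"

text \<open>
  For \<open>A \<in> block_starts q n\<close> this is the permutation that turns every block by one adjacent cycle
  and fixes all other points. A truncated difference \<open>x + 1 - q = 0\<close> is harmless in the
  second test, because the starts are positive.
\<close>
definition rotate_blocks :: "nat \<Rightarrow> nat set \<Rightarrow> nat \<Rightarrow> nat" where
  "rotate_blocks q A x =
     (if \<exists>a\<in>A. a \<le> x \<and> x + 1 < a + q then x + 1
      else if x + 1 - q \<in> A then x + 1 - q else x)"

text \<open>
  If \<open>b\<close> lay inside the block of \<open>a\<close>, the last point of that block would be an inner point of the
  block of \<open>b\<close>, and so it would be moved one step to the right instead of back to \<open>a\<close>.
\<close>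
lemma AqC_starts_separated:
  assumes "is_AqC_at q n p a" "is_AqC_at q n p b" "a < b"
  shows "a + q \<le> b"
proof (rule ccontr)
  assume overlap: "\<not> a + q \<le> b"
  define i where "i = a + q - 1 - b"
  have i: "b + i = a + q - 1" "i + 2 \<le> q"
    using overlap assms(3) by (auto simp: i_def)
  have "p (b + i) = b + i + 1"
    using assms(2) i(2) unfolding is_AqC_at_def by blast
  moreover have "p (b + i) = a"
    using assms(1) i(1) unfolding is_AqC_at_def by simp
  ultimately show False using i by simp
qed

lemma finite_block_starts: "finite (block_starts q n)"
  by (rule finite_subset[of _ "Pow {1..n}"]) (auto simp: block_starts_def)

lemma block_starts_imp_finite: "A \<in> block_starts q n \<Longrightarrow> finite A"
  using finite_subset by (auto simp: block_starts_def)

lemma blocks_subset: "A \<in> block_starts q n \<Longrightarrow> blocks q A \<subseteq> {1..n}"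
  by (fastforce simp: block_starts_def blocks_def)

lemma card_blocks:
  assumes "A \<in> block_starts q n"
  shows "card (blocks q A) = q * card A"
proof -
  have "card (blocks q A) = (\<Sum>a\<in>A. card {a..<a + q})"
    unfolding blocks_def
  proof (rule card_UN_disjoint)
    show "finite A" by (rule block_starts_imp_finite[OF assms])
    show "\<forall>a\<in>A. \<forall>b\<in>A. a \<noteq> b \<longrightarrow> {a..<a + q} \<inter> {b..<b + q} = {}"
    proof (intro ballI impI)
      fix a b assume "a \<in> A" "b \<in> A" "a \<noteq> b"
      hence "a + q \<le> b \<or> b + q \<le> a"
        using assms unfolding block_starts_def
        by (metis (mono_tags, lifting) mem_Collect_eq nat_neq_iff)
      thus "{a..<a + q} \<inter> {b..<b + q} = {}" by auto
    qed
  qed auto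
  thus ?thesis by simp
qed

lemma rotate_blocks_inner:
  assumes "a \<in> A" "i + 2 \<le> q"
  shows "rotate_blocks q A (a + i) = a + i + 1"
proof -
  have "\<exists>a'\<in>A. a' \<le> a + i \<and> a + i + 1 < a' + q"
    using assms by (intro bexI[of _ a]) auto
  thus ?thesis unfolding rotate_blocks_def by simp
qed

lemma rotate_blocks_last:
  assumes "q \<ge> 1" "A \<in> block_starts q n" "a \<in> A"
  shows "rotate_blocks q A (a + q - 1) = a"
proof -
  \<comment> \<open>The last point of a block is not an inner point of another one, by the separation of starts.\<close>
  have "\<not> (\<exists>b\<in>A. b \<le> a + q - 1 \<and> a + q - 1 + 1 < b + q)"
  proof
    assume "\<exists>b\<in>A. b \<le> a + q - 1 \<and> a + q - 1 + 1 < b + q"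
    then obtain b where b: "b \<in> A" "b \<le> a + q - 1" "a + q - 1 + 1 < b + q" by blast
    hence "a < b" by linarith
    hence "a + q \<le> b" using assms(2,3) b(1) unfolding block_starts_def by blast
    thus False using b(2) assms(1) by linarith
  qed
  thus ?thesis using assms unfolding rotate_blocks_def by simp
qed

lemma rotate_blocks_outside:
  assumes "q \<ge> 1" "A \<in> block_starts q n" "x \<notin> blocks q A"
  shows "rotate_blocks q A x = x"
proof -
  have "\<not> (\<exists>a\<in>A. a \<le> x \<and> x + 1 < a + q)"
    using assms(3) by (auto simp: blocks_def)
  moreover have "x + 1 - q \<notin> A"
  proof
    assume *: "x + 1 - q \<in> A"
    hence "1 \<le> x + 1 - q" using assms(2) by (auto simp: block_starts_def)
    hence "x \<in> {x + 1 - q..<x + 1 - q + q}" using assms(1) by auto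
    thus False using * assms(3) unfolding blocks_def by blast
  qed
  ultimately show ?thesis unfolding rotate_blocks_def by simp
qed

lemma rotate_blocks_image:
  assumes "q \<ge> 1" "A \<in> block_starts q n"
  shows "rotate_blocks q A ` blocks q A = blocks q A"
proof
  show "rotate_blocks q A ` blocks q A \<subseteq> blocks q A"
  proof safe
    fix x assume "x \<in> blocks q A"
    then obtain a where a: "a \<in> A" "a \<le> x" "x < a + q" unfolding blocks_def by auto
    show "rotate_blocks q A x \<in> blocks q A"
    proof (cases "x = a + q - 1")
      case True
      hence "rotate_blocks q A x = a" using rotate_blocks_last[OF assms a(1)] by simp
      thus ?thesis using a(1) assms(1) by (force simp: blocks_def)
    next
      case False
      with a have "rotate_blocks q A (a + (x - a)) = a + (x - a) + 1"
        by (intro rotate_blocks_inner) auto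
      hence "rotate_blocks q A x = x + 1" using a by simp
      thus ?thesis using a False unfolding blocks_def by (intro UN_I[of a]) auto
    qed
  qed
  show "blocks q A \<subseteq> rotate_blocks q A ` blocks q A"
  proof
    fix y assume "y \<in> blocks q A"
    then obtain a where a: "a \<in> A" "a \<le> y" "y < a + q" unfolding blocks_def by auto
    show "y \<in> rotate_blocks q A ` blocks q A"
    proof (cases "y = a")
      case True
      have "a + q - 1 \<in> blocks q A" using a assms(1) unfolding blocks_def by (intro UN_I[of a]) auto
      thus ?thesis using rotate_blocks_last[OF assms a(1)] True by (metis image_eqI)
    next
      case False
      have "rotate_blocks q A (a + (y - 1 - a)) = a + (y - 1 - a) + 1"
        using a False by (intro rotate_blocks_inner) auto
      hence "rotate_blocks q A (y - 1) = y" using a False by simp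
      moreover have "y - 1 \<in> blocks q A" using a False unfolding blocks_def by (intro UN_I[of a]) auto
      ultimately show ?thesis by (metis image_eqI)
    qed
  qed
qed

lemma rotate_blocks_permutes:
  assumes "q \<ge> 1" "A \<in> block_starts q n"
  shows "rotate_blocks q A permutes blocks q A"
proof (rule bij_imp_permutes)
  have fin: "finite (blocks q A)"
    using blocks_subset[OF assms(2)] finite_subset by blast
  show "bij_betw (rotate_blocks q A) (blocks q A) (blocks q A)"
    unfolding bij_betw_def
    using eq_card_imp_inj_on[OF fin, of "rotate_blocks q A"] rotate_blocks_image[OF assms] by simp
qed (rule rotate_blocks_outside[OF assms])

text \<open>
  This turns a condition on cycles into prescribed values on a set, so that the permutations that
  satisfy it can be counted as extensions of one fixed permutation.
\<close>
lemma AqC_at_iff_rotate_blocks: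
  assumes "q \<ge> 1" "A \<in> block_starts q n"
  shows "(\<forall>a\<in>A. is_AqC_at q n p a) \<longleftrightarrow> (\<forall>x\<in>blocks q A. p x = rotate_blocks q A x)"
proof
  assume L: "\<forall>a\<in>A. is_AqC_at q n p a"
  show "\<forall>x\<in>blocks q A. p x = rotate_blocks q A x"
  proof
    fix x assume "x \<in> blocks q A"
    then obtain a where a: "a \<in> A" "a \<le> x" "x < a + q" unfolding blocks_def by auto
    have cyc: "is_AqC_at q n p a" using L a(1) by blast
    show "p x = rotate_blocks q A x"
    proof (cases "x = a + q - 1")
      case True
      thus ?thesis using rotate_blocks_last[OF assms a(1)] cyc unfolding is_AqC_at_def by simp
    next
      case False
      define i where "i = x - a"
      have i: "x = a + i" "i + 2 \<le> q" using False a by (auto simp: i_def)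
      thus ?thesis using rotate_blocks_inner[OF a(1) i(2)] cyc unfolding is_AqC_at_def by simp
    qed
  qed
next
  assume R: "\<forall>x\<in>blocks q A. p x = rotate_blocks q A x"
  show "\<forall>a\<in>A. is_AqC_at q n p a"
  proof
    fix a assume a: "a \<in> A"
    have mem: "a + i \<in> blocks q A" if "i < q" for i
      using a that unfolding blocks_def by (intro UN_I[of a]) auto
    have "1 \<le> a" "a + q - 1 \<le> n"
      using a assms(2) by (auto simp: block_starts_def)
    moreover have "p (a + i) = a + i + 1" if "i + 2 \<le> q" for i
      using R mem[of i] rotate_blocks_inner[OF a that] that by simp
    moreover have "p (a + q - 1) = a"
      using R mem[of "q - 1"] rotate_blocks_last[OF assms a] assms(1) by simp
    ultimately show "is_AqC_at q n p a" unfolding is_AqC_at_def by blast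
  qed
qed

text \<open>
  Composition with \<open>\<sigma>\<close> is a bijection from the permutations of \<open>S - U\<close> to the extensions
  of \<open>\<sigma>\<close> to \<open>S\<close>.
\<close>
lemma card_permutes_extending:
  assumes "finite S" "U \<subseteq> S" and \<sigma>: "\<sigma> permutes U"
  shows "card {p. p permutes S \<and> (\<forall>x\<in>U. p x = \<sigma> x)} = fact (card (S - U))"
proof -
  have \<sigma>S: "\<sigma> permutes S" using permutes_subset[OF \<sigma> assms(2)] .
  have "bij_betw (\<lambda>p. p \<circ> \<sigma>) {p. p permutes S - U} {p. p permutes S \<and> (\<forall>x\<in>U. p x = \<sigma> x)}"
  proof (rule bij_betw_byWitness[where f' = "\<lambda>p. p \<circ> inv \<sigma>"])
    show "\<forall>p\<in>{p. p permutes S - U}. p \<circ> \<sigma> \<circ> inv \<sigma> = p"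
      using permutes_inv_o(1)[OF \<sigma>] by (simp add: o_assoc[symmetric])
    show "\<forall>p\<in>{p. p permutes S \<and> (\<forall>x\<in>U. p x = \<sigma> x)}. p \<circ> inv \<sigma> \<circ> \<sigma> = p"
      using permutes_inv_o(2)[OF \<sigma>] by (simp add: o_assoc[symmetric])
    show "(\<lambda>p. p \<circ> \<sigma>) ` {p. p permutes S - U} \<subseteq> {p. p permutes S \<and> (\<forall>x\<in>U. p x = \<sigma> x)}"
    proof safe
      fix p assume p: "p permutes S - U"
      show "p \<circ> \<sigma> permutes S"
        using permutes_compose[OF \<sigma>S permutes_subset[OF p]] by blast
      fix x assume "x \<in> U"
      hence "\<sigma> x \<notin> S - U" using permutes_in_image[OF \<sigma>] by simp
      thus "(p \<circ> \<sigma>) x = \<sigma> x" using permutes_not_in[OF p] by simp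
    qed
    show "(\<lambda>p. p \<circ> inv \<sigma>) ` {p. p permutes S \<and> (\<forall>x\<in>U. p x = \<sigma> x)} \<subseteq> {p. p permutes S - U}"
    proof safe
      fix p assume p: "p permutes S" "\<forall>x\<in>U. p x = \<sigma> x"
      show "p \<circ> inv \<sigma> permutes S - U"
      proof (rule permutes_superset)
        show "p \<circ> inv \<sigma> permutes S"
          by (rule permutes_compose[OF permutes_inv[OF \<sigma>S] p(1)])
        fix x assume "x \<in> S - (S - U)"
        hence "inv \<sigma> x \<in> U" using permutes_in_image[OF permutes_inv[OF \<sigma>]] by simp
        hence "p (inv \<sigma> x) = \<sigma> (inv \<sigma> x)" using p(2) by blast
        thus "(p \<circ> inv \<sigma>) x = x" using permutes_inverses(1)[OF \<sigma>] by simp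
      qed
    qed
  qed
  hence "card {p. p permutes S \<and> (\<forall>x\<in>U. p x = \<sigma> x)} = card {p. p permutes S - U}"
    by (rule bij_betw_same_card[symmetric])
  also have "\<dots> = fact (card (S - U))"
    using assms(1) by (intro card_permutations) auto
  finally show ?thesis .
qed

lemma card_permutes_AqC_at:
  assumes "q \<ge> 1" "A \<in> block_starts q n"
  shows "card {p. p permutes {1..n} \<and> (\<forall>a\<in>A. is_AqC_at q n p a)} = fact (n - q * card A)"
proof -
  have sub: "blocks q A \<subseteq> {1..n}" by (rule blocks_subset[OF assms(2)])
  have "card ({1..n} - blocks q A) = n - q * card A"
    using card_Diff_subset[OF finite_subset[OF sub] sub] card_blocks[OF assms(2)] by simp
  thus ?thesis
    using card_permutes_extending[OF _ sub rotate_blocks_permutes[OF assms]]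
    by (simp add: AqC_at_iff_rotate_blocks[OF assms])
qed

lemma AqC_starts_in_block_starts:
  assumes "A \<subseteq> {1..n}" "\<forall>a\<in>A. is_AqC_at q n p a"
  shows "A \<in> block_starts q n"
  unfolding block_starts_def
proof (intro CollectI conjI ballI impI)
  fix a assume "a \<in> A"
  hence "a + q - 1 \<le> n" using assms(2) by (auto simp: is_AqC_at_def)
  thus "a + q \<le> n + 1" by linarith
next
  fix a b assume "a \<in> A" "b \<in> A" "a < b"
  thus "a + q \<le> b" using assms(2) AqC_starts_separated by blast
qed (rule assms(1))

section \<open>Inclusion and exclusion over sets of blocks\<close>

lemma sum_Pow_alternating:
  assumes "finite D"
  shows "(\<Sum>A\<in>Pow D. (-1) ^ card A) = (if D = {} then 1 else 0 :: real)"
proof -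
  have "(\<Prod>x\<in>D. 1 - 1 :: real) = (\<Sum>A\<in>Pow D. (-1) ^ card A * (\<Prod>x\<in>A. 1) * (\<Prod>x\<in>D - A. 1))"
    by (rule prod_diff_conv_sum[OF assms])
  thus ?thesis using assms by (simp add: power_0_left split: if_splits)
qed

text \<open>
  The indicator of the permutations without adjacent cycles is an alternating sum over the subsets
  of the set \<open>D p\<close> of cycle starts of \<open>p\<close>. Exchanging the two summations leaves, for each set
  \<open>A\<close>, the number of permutations that have adjacent cycles at all points of \<open>A\<close>.
\<close>
lemma num_without_AqC_block_starts:
  assumes "q \<ge> 1"
  shows "real (num_without_AqC q n) =
    (\<Sum>A\<in>block_starts q n. (-1) ^ card A * fact (n - q * card A))"
proof -
  define P where "P = {p. p permutes {1..n}}"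
  define D where "D p = {a. is_AqC_at q n p a}" for p
  have finP: "finite P" unfolding P_def by (rule finite_permutations) simp
  have D_sub: "D p \<subseteq> {1..n}" for p
    using assms by (auto simp: D_def is_AqC_at_def)
  have finD: "finite (D p)" for p using D_sub finite_subset by blast
  have "{p. p permutes {1..n} \<and> \<not> (\<exists>a. is_AqC_at q n p a)} = {p\<in>P. D p = {}}"
    by (auto simp: P_def D_def)
  hence "real (num_without_AqC q n) = (\<Sum>p\<in>P. if D p = {} then 1 else 0)"
    using finP by (simp add: num_without_AqC_def sum.If_cases Int_def)
  also have "\<dots> = (\<Sum>p\<in>P. \<Sum>A\<in>Pow (D p). (-1) ^ card A)"
    by (simp add: sum_Pow_alternating[OF finD])
  also have "\<dots> = (\<Sum>p\<in>P. \<Sum>A | A \<in> Pow {1..n} \<and> A \<subseteq> D p. (-1) ^ card A)"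
    using D_sub by (intro sum.cong refl) auto
  also have "\<dots> = (\<Sum>A\<in>Pow {1..n}. \<Sum>p | p \<in> P \<and> A \<subseteq> D p. (-1) ^ card A)"
    by (rule sum.swap_restrict[OF finP]) simp
  also have "\<dots> = (\<Sum>A\<in>block_starts q n. \<Sum>p | p \<in> P \<and> A \<subseteq> D p. (-1) ^ card A)"
  proof (rule sum.mono_neutral_right)
    show "\<forall>A\<in>Pow {1..n} - block_starts q n. (\<Sum>p | p \<in> P \<and> A \<subseteq> D p. (- 1) ^ card A) = (0::real)"
    proof
      fix A assume "A \<in> Pow {1..n} - block_starts q n"
      hence "{p \<in> P. A \<subseteq> D p} = {}"
        using AqC_starts_in_block_starts[of A n q] by (auto simp: D_def)
      thus "(\<Sum>p | p \<in> P \<and> A \<subseteq> D p. (- 1) ^ card A) = (0::real)"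
        by (simp only: sum.empty)
    qed
  qed (auto simp: block_starts_def)
  also have "\<dots> = (\<Sum>A\<in>block_starts q n. (-1) ^ card A * fact (n - q * card A))"
  proof (rule sum.cong[OF refl])
    fix A assume A: "A \<in> block_starts q n"
    have "{p \<in> P. A \<subseteq> D p} = {p. p permutes {1..n} \<and> (\<forall>a\<in>A. is_AqC_at q n p a)}"
      by (auto simp: P_def D_def)
    thus "(\<Sum>p | p \<in> P \<and> A \<subseteq> D p. (-1) ^ card A) = (-1) ^ card A * (fact (n - q * card A) :: real)"
      using card_permutes_AqC_at[OF assms A] by simp
  qed
  finally show ?thesis .
qed

section \<open>An explicit formula\<close>

text \<open>
  The distinction is whether the last possible start \<open>n + 1 - q\<close> is used. If so, its block
  occupies the top \<open>q\<close> points, and the other blocks are arbitrary among the remaining \<open>n - q\<close>.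
\<close>
lemma card_block_starts_Suc:
  assumes "q \<ge> 1" "q \<le> n"
  shows "card {A \<in> block_starts q n. card A = Suc k} =
    card {A \<in> block_starts q (n - 1). card A = Suc k} + card {A \<in> block_starts q (n - q). card A = k}"
proof -
  define s where "s = n + 1 - q"
  define X where "X = {A \<in> block_starts q (n - 1). card A = Suc k}"
  define Y where "Y = {A \<in> block_starts q (n - q). card A = k}"
  have s: "s + q = n + 1" "1 \<le> s" "s \<le> n" using assms by (auto simp: s_def)
  have "{A \<in> block_starts q n. card A = Suc k} = X \<union> insert s ` Y"
  proof (intro equalityI subsetI)
    fix A assume A: "A \<in> {A \<in> block_starts q n. card A = Suc k}"
    have le_s: "a \<le> s" if "a \<in> A" for a
      using A that s by (auto simp: block_starts_def)
    show "A \<in> X \<union> insert s ` Y"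
    proof (cases "s \<in> A")
      case False
      hence "a < s" if "a \<in> A" for a using le_s[OF that] that by (metis le_neq_implies_less)
      hence "A \<in> X" using A s by (fastforce simp: X_def block_starts_def)
      thus ?thesis ..
    next
      case True
      have "finite A" using A block_starts_imp_finite by blast
      hence card: "card (A - {s}) = k" using A True by simp
      have sep: "a + q \<le> s" if "a \<in> A - {s}" for a
      proof -
        have "a < s" using le_s[of a] that by auto
        thus ?thesis using A True that by (auto simp: block_starts_def)
      qed
      have "A - {s} \<in> block_starts q (n - q)"
        unfolding block_starts_def
      proof (intro CollectI conjI ballI impI subsetI)
        fix a assume a: "a \<in> A - {s}"
        show "a \<in> {1..n - q}" using sep[OF a] a A s assms by (auto simp: block_starts_def)
        show "a + q \<le> n - q + 1" using sep[OF a] s assms by auto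
      next
        fix a b assume "a \<in> A - {s}" "b \<in> A - {s}" "a < b"
        thus "a + q \<le> b" using A by (auto simp: block_starts_def)
      qed
      hence "A - {s} \<in> Y" using card by (simp add: Y_def)
      thus ?thesis using True by (metis UnI2 image_eqI insert_Diff)
    qed
  next
    fix A assume "A \<in> X \<union> insert s ` Y"
    thus "A \<in> {A \<in> block_starts q n. card A = Suc k}"
    proof
      assume "A \<in> X"
      thus ?thesis by (fastforce simp: X_def block_starts_def)
    next
      assume "A \<in> insert s ` Y"
      then obtain B where B: "A = insert s B" "B \<in> Y" by blast
      have low: "1 \<le> b" "b + q \<le> s" if "b \<in> B" for b
        using B(2) that s assms by (auto simp: Y_def block_starts_def)
      have fin: "finite B" using B(2) block_starts_imp_finite by (auto simp: Y_def)
      have "s \<notin> B" using low(2)[of s] assms by auto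
      hence "card A = Suc k" using B fin by (simp add: Y_def)
      moreover have "A \<in> block_starts q n"
        unfolding block_starts_def
      proof (intro CollectI conjI ballI impI subsetI)
        fix a assume "a \<in> A"
        thus "a \<in> {1..n}" "a + q \<le> n + 1" using B(1) s low[of a] by auto
      next
        fix a b assume ab: "a \<in> A" "b \<in> A" "a < b"
        have "a \<in> B" using ab low(2)[of b] B(1) by auto
        show "a + q \<le> b"
        proof (cases "b \<in> B")
          case True
          thus ?thesis using \<open>a \<in> B\<close> ab B(2) by (auto simp: Y_def block_starts_def)
        next
          case False
          thus ?thesis using low(2)[OF \<open>a \<in> B\<close>] ab B(1) by simp
        qed
      qed
      ultimately show ?thesis by simp
    qed
  qed
  moreover have "X \<inter> insert s ` Y = {}"
    using s by (auto simp: X_def block_starts_def)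
  moreover have "card (insert s ` Y) = card Y"
  proof (rule card_image, rule inj_onI)
    fix B C assume BC: "B \<in> Y" "C \<in> Y" "insert s B = insert s C"
    have "s \<notin> B" "s \<notin> C" using BC(1,2) assms s by (auto simp: Y_def block_starts_def)
    thus "B = C" using BC(3) by (metis insert_ident)
  qed
  ultimately show ?thesis
    using finite_block_starts by (simp add: card_Un_disjoint X_def Y_def)
qed

text \<open>
  The recursion becomes Pascal's rule, since lowering \<open>n\<close> by \<open>q\<close> and \<open>k\<close> by one lowers
  \<open>n - (q - 1) * k\<close> by one. For \<open>q * k > n\<close> there are no such sets, and the
  binomial coefficient vanishes too, even where the subtraction is truncated.
\<close>
lemma card_block_starts:
  assumes "q \<ge> 1"
  shows "card {A \<in> block_starts q n. card A = k} = (n - (q - 1) * k) choose k"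
proof (induction n arbitrary: k rule: less_induct)
  case (less n)
  show ?case
  proof (cases k)
    case 0
    have "{A \<in> block_starts q n. card A = 0} = {{}}"
      using block_starts_imp_finite by (auto simp: block_starts_def)
    thus ?thesis using 0 by simp
  next
    case (Suc j)
    show ?thesis
    proof (cases "q \<le> n")
      case False
      have "A = {}" if "A \<in> block_starts q n" for A
        using that False by (force simp: block_starts_def)
      hence "{A \<in> block_starts q n. card A = k} = {}" using Suc by fastforce
      moreover have "n - (q - 1) * k = 0" using False Suc by simp
      ultimately show ?thesis using Suc by (simp only: card.empty binomial_0_Suc)
    next
      case True
      have IH: "card {A \<in> block_starts q (n - 1). card A = Suc j} = (n - 1 - (q - 1) * Suc j) choose Suc j"
               "card {A \<in> block_starts q (n - q). card A = j} = (n - q - (q - 1) * j) choose j"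
        using True assms by (intro less.IH; simp)+
      define r where "r = n - 1 - (q - 1) * Suc j"
      have r: "n - q - (q - 1) * j = r" using assms by (simp add: r_def)
      have "(r choose Suc j) + (r choose j) = (n - (q - 1) * Suc j) choose Suc j"
        \<comment> \<open>In the second case both upper indices are truncated to 0, so Pascal's rule does not apply,
            but \<open>q \<le> n\<close> forces \<open>j > 0\<close> and all three coefficients are 0.\<close>
      proof (cases "(q - 1) * Suc j < n")
        case True
        hence "n - (q - 1) * Suc j = Suc r" by (simp add: r_def)
        thus ?thesis by simp
      next
        case False
        hence "r = 0" "n - (q - 1) * Suc j = 0" by (simp_all add: r_def)
        moreover have "j \<noteq> 0"
        proof
          assume "j = 0"
          with False \<open>q \<le> n\<close> assms show False by simp
        qed
        ultimately show ?thesis by simp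
      qed
      thus ?thesis
        unfolding Suc card_block_starts_Suc[OF assms True] IH r by (simp add: r_def)
    qed
  qed
qed

lemma num_without_AqC_formula:
  assumes "q \<ge> 1"
  shows "real (num_without_AqC q n) =
    (\<Sum>k\<le>n div q. (-1) ^ k * fact (n - (q - 1) * k) / fact k)"
proof -
  have card_le: "card A \<in> {..n div q}" if "A \<in> block_starts q n" for A
  proof -
    have "q * card A \<le> n"
      using card_mono[OF _ blocks_subset[OF that]] card_blocks[OF that] by simp
    thus ?thesis using assms by (simp add: less_eq_div_iff_mult_less_eq mult.commute)
  qed
  have "real (num_without_AqC q n) =
      (\<Sum>k\<le>n div q. \<Sum>A | A \<in> block_starts q n \<and> card A = k. (-1) ^ card A * fact (n - q * card A))"
    unfolding num_without_AqC_block_starts[OF assms]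
    using card_le by (intro sum.group[symmetric] finite_block_starts) auto
  also have "\<dots> = (\<Sum>k\<le>n div q. (-1) ^ k * fact (n - (q - 1) * k) / fact k)"
  proof (rule sum.cong[OF refl])
    fix k assume "k \<in> {..n div q}"
    hence k: "q * k \<le> n" using assms by (simp add: less_eq_div_iff_mult_less_eq mult.commute)
    have split: "q * k = (q - 1) * k + k" using assms by (simp add: algebra_simps)
    have "k \<le> n - (q - 1) * k" "n - (q - 1) * k - k = n - q * k" using k split by linarith+
    hence "real ((n - (q - 1) * k) choose k) = fact (n - (q - 1) * k) / (fact k * fact (n - q * k))"
      using binomial_fact[of k "n - (q - 1) * k", where 'a = real] by simp
    hence "real (card {A \<in> block_starts q n. card A = k}) * fact (n - q * k)
        = fact (n - (q - 1) * k) / fact k"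
      by (simp add: card_block_starts[OF assms])
    moreover have "(\<Sum>A | A \<in> block_starts q n \<and> card A = k. (-1) ^ card A * fact (n - q * card A))
        = real (card {A \<in> block_starts q n. card A = k}) * ((-1) ^ k * fact (n - q * k))"
      by simp
    ultimately show "(\<Sum>A | A \<in> block_starts q n \<and> card A = k. (-1) ^ card A * fact (n - q * card A))
        = (-1) ^ k * (fact (n - (q - 1) * k) :: real) / fact k"
      by (simp add: mult.left_commute)
  qed
  finally show ?thesis .
qed

section \<open>The recurrence\<close>

lemma num_without_AqC_small:
  assumes "n < q"
  shows "real (num_without_AqC q n) = fact n"
  using num_without_AqC_formula[of q n] assms by simp

text \<open>
  Write \<open>c n k\<close> for the terms of the explicit formula. For \<open>r = m - 1 - (q - 1) * (j + 1)\<close> one has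
  \<open>m = (r + 1) + (q - 1) * (j + 1)\<close>. Hence the factor \<open>r + 1\<close> of \<open>(r + 1)!\<close> in \<open>c m (j + 1)\<close> is
  \<open>m\<close> minus \<open>(q - 1) * (j + 1)\<close>, and the factor \<open>j + 1\<close> cancels against \<open>(j + 1)!\<close>; that is the
  relation \<open>c_Suc\<close>. It holds below the top index \<open>m / q\<close>, which exists only when \<open>q\<close> divides
  \<open>m\<close> and is treated apart.
\<close>
lemma num_without_AqC_rec:
  assumes "q \<ge> 1" "m \<ge> q"
  shows "real (num_without_AqC q m) = real m * real (num_without_AqC q (m - 1))
    + real (q - 1) * real (num_without_AqC q (m - q))
    + (if q dvd m then real q * (-1) ^ (m div q) else 0)"
proof -
  define c :: "nat \<Rightarrow> nat \<Rightarrow> real"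
    where "c n k = (-1) ^ k * fact (n - (q - 1) * k) / fact k" for n k
  have b: "real (num_without_AqC q n) = (\<Sum>k\<le>n div q. c n k)" for n
    unfolding c_def by (rule num_without_AqC_formula[OF assms(1)])
  have c_zero: "c m 0 = real m * c (m - 1) 0"
    using assms fact_reduce[of m, where 'a = real] by (simp add: c_def)
  have c_Suc: "c m (Suc j) = real m * c (m - 1) (Suc j) + real (q - 1) * c (m - q) j"
    if "q * Suc j < m" for j
  proof -
    define r where "r = m - 1 - (q - 1) * Suc j"
    have split: "q * Suc j = (q - 1) * Suc j + Suc j" using assms(1) by (cases q) simp_all
    have r: "m - (q - 1) * Suc j = Suc r" "m - q - (q - 1) * j = r"
      using that split assms(1) by (simp_all add: r_def)
    have "m = Suc r + (q - 1) * Suc j" using that split r(1) by linarith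
    hence m: "real m = real (Suc r) + real (q - 1) * real (Suc j)"
      by (metis of_nat_add of_nat_mult)
    have f: "fact (Suc j) = real (Suc j) * fact j" "fact (Suc r) = real (Suc r) * fact r"
      by (simp_all only: fact_Suc)
    define X S :: real where "X = (-1) ^ j * fact r / fact j" and "S = real (Suc j)"
    have S: "S \<noteq> 0" by (simp add: S_def)
    have terms: "c m (Suc j) = - (real (Suc r) * X / S)" 
        "c (m - 1) (Suc j) = - (X / S)" "c (m - q) j = X"
      unfolding c_def r r_def[symmetric] f X_def S_def by (simp_all add: mult_ac)
    show ?thesis unfolding terms m S_def[symmetric] using S by (simp add: field_simps del: of_nat_Suc)
  qed
  have step: "(\<Sum>k\<le>K. c m k) =
      real m * (\<Sum>k\<le>K. c (m - 1) k) + real (q - 1) * (\<Sum>j<K. c (m - q) j)" if "q * K < m" for K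
    using that
  proof (induction K)
    case 0
    thus ?case using c_zero by simp
  next
    case (Suc K)
    have "q * K < m" using Suc.prems by simp
    thus ?case using Suc.IH c_Suc[OF Suc.prems] by (simp add: algebra_simps)
  qed
  define L where "L = m div q - 1"
  have "m div q \<ge> 1" using assms by (simp add: less_eq_div_iff_mult_less_eq)
  hence L: "m div q = Suc L" by (simp add: L_def)
  have L': "(m - q) div q = L" using assms L by (simp add: le_div_geq)
  show ?thesis
  proof (cases "q dvd m")
    case False
    have "q * Suc L < m"
      using False L by (metis dvd_triv_left le_neq_implies_less times_div_less_eq_dividend)
    have "(m - 1) div q = Suc L"
      using \<open>q * Suc L < m\<close> dividend_less_times_div[of q m] assms(1) L
      by (intro div_nat_eqI) auto
    thus ?thesis
      using step[OF \<open>q * Suc L < m\<close>] False by (simp add: b L L' lessThan_Suc_atMost)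
  next
    case True
    hence m: "m = q * Suc L" using L by (metis dvd_mult_div_cancel)
    have split: "m = (q - 1) * Suc L + Suc L" "m - q = (q - 1) * L + L"
      using assms(1) by (cases q; simp add: m)+
    have top: "c m (Suc L) = - ((-1) ^ L)" "c (m - q) L = (-1) ^ L"
    proof -
      have arg: "m - (q - 1) * Suc L = Suc L" "m - q - (q - 1) * L = L" using split by linarith+
      show "c m (Suc L) = - ((-1) ^ L)" "c (m - q) L = (-1) ^ L"
        unfolding c_def arg by (simp_all del: fact_Suc)
    qed
    have "(m - 1) div q = L"
      using assms(1) by (intro div_nat_eqI) (auto simp: m)
    hence b_pred: "real (num_without_AqC q (m - 1)) = (\<Sum>k\<le>L. c (m - 1) k)" by (simp add: b)
    have b_top: "real (num_without_AqC q m) = (\<Sum>k\<le>L. c m k) - (-1) ^ L"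
      using top(1) by (simp add: b L)
    have b_diff: "real (num_without_AqC q (m - q)) = (\<Sum>j<L. c (m - q) j) + (-1) ^ L"
      unfolding b L' lessThan_Suc_atMost[symmetric] sum.lessThan_Suc top(2) ..
    have "q * L < m" using m assms(1) by simp
    note step_L = step[OF this]
    have inhom: "(if q dvd m then real q * (-1) ^ (m div q) else 0) = - (real (q - 1) + 1) * (-1) ^ L"
      using True L assms(1) by simp
    show ?thesis
      unfolding inhom b_pred b_top b_diff step_L by (simp add: algebra_simps del: of_nat_diff)
  qed
qed

section \<open>Comparison of coefficients\<close>

lemma fact_mult_fps_nth_deriv_nth:
  fixes f :: "real fps"
  shows "fact n * fps_nth (fps_nth_deriv k f) n = fact (n + k) * fps_nth f (n + k)"
proof (induction k arbitrary: f)
  case (Suc k)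
  have "fact n * fps_nth (fps_nth_deriv (Suc k) f) n = fact (n + k) * fps_nth (fps_deriv f) (n + k)"
    using Suc.IH[of "fps_deriv f"] by simp
  thus ?case by (simp add: algebra_simps)
qed simp

text \<open>
  In the topology of formal power series every coefficient of the partial sums is eventually
  constant; the coefficient at \<open>m\<close> no longer changes once \<open>m\<close> terms have been summed.
\<close>
lemma w_AqC_nth:
  assumes "q \<ge> 1"
  shows "fps_nth (w_AqC q) m = (if q dvd m \<and> m > 0 then (-1) ^ (m div q) / fact m else 0)"
proof -
  let ?f = "\<lambda>i. fps_const ((-1) ^ Suc i / fact (q * Suc i)) * fps_X ^ (q * Suc i) :: real fps"
  have nth: "fps_nth (?f i) m = (if m = q * Suc i then (-1) ^ Suc i / fact m else 0)" for i
    by (simp add: fps_X_power_nth del: mult_Suc_right power_Suc fact_Suc)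
  have sum: "(\<Sum>i<n. fps_nth (?f i) m) = (if q dvd m \<and> m > 0 then (-1) ^ (m div q) / fact m else 0)"
    if "n \<ge> m" for n
  proof (cases "q dvd m \<and> m > 0")
    case True
    then obtain i where i: "m = q * Suc i" by (metis dvdE gr0_implies_Suc mult_0_right neq0_conv)
    have only_i: "fps_nth (?f j) m = (if j = i then (-1) ^ Suc i / fact m else 0)" for j
      using i assms by (auto simp: nth simp del: mult_Suc_right power_Suc fact_Suc)
    have "Suc i \<le> m" using assms i by (metis mult_le_mono1 mult_1)
    hence "i < n" using that by simp
    moreover have "m div q = Suc i" using assms i by simp
    ultimately show ?thesis
      using True by (simp only: only_i sum.delta finite_lessThan lessThan_iff) simp
  next
    case False
    hence "m \<noteq> q * Suc i" for i using assms by auto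
    thus ?thesis using False by (simp only: nth) simp
  qed
  have "\<forall>\<^sub>F n in sequentially. fps_nth (\<Sum>i<n. ?f i) m = fps_nth (w_AqC q) m"
    using w_AqC_sums[OF assms] unfolding sums_def tendsto_fps_iff by blast
  then obtain N where "\<And>n. n \<ge> N \<Longrightarrow> fps_nth (\<Sum>i<n. ?f i) m = fps_nth (w_AqC q) m"
    unfolding eventually_sequentially by blast
  from this[of "max N m"] sum[of "max N m"] show ?thesis
    by (simp only: fps_sum_nth max.cobounded1 max.cobounded2)
qed

lemma egf_AqC_nth: "fact n * fps_nth (egf_AqC q) n = real (num_without_AqC q n)"
  by (simp add: egf_AqC_def)

theorem theorem4p2:
  fixes q :: nat
  assumes "q \<ge> 1"
  shows "(1 - fps_X) * fps_nth_deriv q (egf_AqC q) - of_nat q * fps_nth_deriv (q - 1) (egf_AqC q)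
           - of_nat (q - 1) * egf_AqC q = of_nat q * fps_nth_deriv q (w_AqC q)
         \<and> (\<forall>i<q. fps_nth (fps_nth_deriv i (egf_AqC q)) 0 = fact i)"
proof
  let ?G = "egf_AqC q"
  let ?L = "(1 - fps_X) * fps_nth_deriv q ?G - of_nat q * fps_nth_deriv (q - 1) ?G
           - of_nat (q - 1) * ?G"
  let ?b = "\<lambda>n. real (num_without_AqC q n)"
  have G: "fact n * fps_nth (fps_nth_deriv k ?G) n = ?b (n + k)" for n k
    by (simp only: fact_mult_fps_nth_deriv_nth egf_AqC_nth)
  show "?L = of_nat q * fps_nth_deriv q (w_AqC q)"
  proof (rule fps_ext)
    fix n
    have X: "fact n * fps_nth (fps_X * fps_nth_deriv q ?G) n = real n * ?b (n + q - 1)"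
    proof (cases n)
      case (Suc l)
      thus ?thesis using G[of l q] by simp
    qed simp
    have nth: "fps_nth ?L n = fps_nth (fps_nth_deriv q ?G) n - fps_nth (fps_X * fps_nth_deriv q ?G) n
        - real q * fps_nth (fps_nth_deriv (q - 1) ?G) n - real (q - 1) * fps_nth ?G n"
      by (simp only: left_diff_distrib mult_1_left fps_sub_nth fps_mult_of_nat_nth)
    have "fact n * fps_nth ?L n = fact n * fps_nth (fps_nth_deriv q ?G) n
        - fact n * fps_nth (fps_X * fps_nth_deriv q ?G) n
        - real q * (fact n * fps_nth (fps_nth_deriv (q - 1) ?G) n)
        - real (q - 1) * (fact n * fps_nth ?G n)"
      unfolding nth by (simp only: right_diff_distrib mult.left_commute)
    also have "\<dots> = ?b (n + q) - real n * ?b (n + q - 1) - real q * ?b (n + (q - 1)) - real (q - 1) * ?b n"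
      by (simp only: G X egf_AqC_nth)
    also have "\<dots> = ?b (n + q) - real (n + q) * ?b (n + q - 1) - real (q - 1) * ?b n"
      using assms by (simp add: algebra_simps)
    also have "\<dots> = (if q dvd n + q then real q * (-1) ^ ((n + q) div q) else 0)"
      using num_without_AqC_rec[OF assms, of "n + q"] by simp
    also have "\<dots> = real q * (fact (n + q) * fps_nth (w_AqC q) (n + q))"
      using assms by (simp add: w_AqC_nth[OF assms])
    also have "\<dots> = real q * (fact n * fps_nth (fps_nth_deriv q (w_AqC q)) n)"
      by (simp only: fact_mult_fps_nth_deriv_nth)
    also have "\<dots> = fact n * fps_nth (of_nat q * fps_nth_deriv q (w_AqC q)) n"
      by (simp only: fps_mult_of_nat_nth mult.left_commute)
    finally show "fps_nth ?L n = fps_nth (of_nat q * fps_nth_deriv q (w_AqC q)) n"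
      by (metis fact_nonzero mult_left_cancel)
  qed
  show "\<forall>i<q. fps_nth (fps_nth_deriv i ?G) 0 = fact i"
    using G[of 0] num_without_AqC_small by simp
qed

end
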